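(* The quaternion exponential function $z\mapsto e^z$ is $\mathbb{H}$-differentiable at every $z\in\mathbb{H}$, and its $\mathbb{H}$-derivative satisfies $$(e^z)'=e^z .$$
   Context: $\mathbb{H}$ denotes the algebra of real quaternions with its usual norm $|\cdot|$. For $z\in\mathbb{H}$, $e^z=1+z+\frac{z^2}{2!}+\frac{z^3}{3!}+\cdots$. A quaternion function $f$ defined on a neighborhood $G\subset\mathbb{H}$ of a point $z^0$ is called $\mathbb{H}$-differentiable at $z^0$ if there exist two (finite or infinite) sequences of quaternions $A_k=A_k(z^0)$, $B_k=B_k(z^0)$ such that $\sum_k A_kB_k$ is finite (converges) and, for $z^0+h\in G$, $$f(z^0+h)-f(z^0)=\sum_k A_k\, h\, B_k+\omega(z^0,h),\qquad \lim_{h\to0}\frac{|\omega(z^0,h)|}{|h|}=0.$$ In this case the quaternion $f'(z^0)=\sum_k A_kB_k$ is called the $\mathbb{H}$-derivative of $f$ at $z^0$. *)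

theory Defs
  imports "HOL-Analysis.Analysis"
begin

section \<open>The real normed division algebra of quaternions\<close>

codatatype quat = Quat (Re: real) (Im1: real) (Im2: real) (Im3: real)

hide_const (open) Complex.Re

lemma quat_eq_iff:
  "x = y \<longleftrightarrow> Re x = Re y \<and> Im1 x = Im1 y \<and> Im2 x = Im2 y \<and> Im3 x = Im3 y"
  by (auto intro: quat.expand)

instantiation quat :: ab_group_add
begin

primcorec zero_quat where
  "Re 0 = 0"
| "Im1 0 = 0"
| "Im2 0 = 0"
| "Im3 0 = 0"

primcorec plus_quat where
  "Re (x + y) = Re x + Re y"
| "Im1 (x + y) = Im1 x + Im1 y"
| "Im2 (x + y) = Im2 x + Im2 y"
| "Im3 (x + y) = Im3 x + Im3 y"

primcorec uminus_quat where
  "Re (- x) = - Re x"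
| "Im1 (- x) = - Im1 x"
| "Im2 (- x) = - Im2 x"
| "Im3 (- x) = - Im3 x"

primcorec minus_quat where
  "Re (x - y) = Re x - Re y"
| "Im1 (x - y) = Im1 x - Im1 y"
| "Im2 (x - y) = Im2 x - Im2 y"
| "Im3 (x - y) = Im3 x - Im3 y"

instance
  by standard (simp_all add: quat_eq_iff)

end

instantiation quat :: ring_1
begin

primcorec one_quat where
  "Re 1 = 1"
| "Im1 1 = 0"
| "Im2 1 = 0"
| "Im3 1 = 0"

primcorec times_quat where
  "Re (x * y) = Re x * Re y - Im1 x * Im1 y - Im2 x * Im2 y - Im3 x * Im3 y"
| "Im1 (x * y) = Re x * Im1 y + Im1 x * Re y + Im2 x * Im3 y - Im3 x * Im2 y"
| "Im2 (x * y) = Re x * Im2 y - Im1 x * Im3 y + Im2 x * Re y + Im3 x * Im1 y"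
| "Im3 (x * y) = Re x * Im3 y + Im1 x * Im2 y - Im2 x * Im1 y + Im3 x * Re y"

instance
  by standard (simp_all add: quat_eq_iff algebra_simps)

end

instantiation quat :: real_algebra_1
begin

primcorec scaleR_quat where
  "Re (scaleR r x) = r * Re x"
| "Im1 (scaleR r x) = r * Im1 x"
| "Im2 (scaleR r x) = r * Im2 x"
| "Im3 (scaleR r x) = r * Im3 x"

instance
  by standard (simp_all add: quat_eq_iff algebra_simps)

end

instantiation quat :: real_inner
begin

definition inner_quat_def:
  "inner x y = Re x * Re y + Im1 x * Im1 y + Im2 x * Im2 y + Im3 x * Im3 y" for x y :: quat

definition norm_quat_def:
  "norm x = sqrt ((Re x)\<^sup>2 + (Im1 x)\<^sup>2 + (Im2 x)\<^sup>2 + (Im3 x)\<^sup>2)" for x :: quat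

definition sgn_quat_def: "sgn x = x /\<^sub>R norm x" for x :: quat

definition dist_quat_def: "dist x y = norm (x - y)" for x y :: quat

definition uniformity_quat_def [code del]:
  "(uniformity :: (quat \<times> quat) filter) = (INF e\<in>{0 <..}. principal {(x, y). dist x y < e})"

definition open_quat_def [code del]:
  "open (U :: quat set) \<longleftrightarrow> (\<forall>x\<in>U. eventually (\<lambda>(x', y). x' = x \<longrightarrow> y \<in> U) uniformity)"

instance
proof
  fix x y z :: quat and r :: real and U :: "quat set"
  show "dist x y = norm (x - y)" by (rule dist_quat_def)
  show "sgn x = x /\<^sub>R norm x" by (rule sgn_quat_def)
  show "uniformity = (INF e\<in>{0 <..}. principal {(x, y :: quat). dist x y < e})"
    by (rule uniformity_quat_def)
  show "open U \<longleftrightarrow> (\<forall>x\<in>U. eventually (\<lambda>(x', y). x' = x \<longrightarrow> y \<in> U) uniformity)"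
    by (rule open_quat_def)
  show "inner x y = inner y x" by (simp add: inner_quat_def mult.commute)
  show "inner (x + y) z = inner x z + inner y z" by (simp add: inner_quat_def algebra_simps)
  show "inner (scaleR r x) y = r * inner x y" by (simp add: inner_quat_def algebra_simps)
  show "0 \<le> inner x x" by (simp add: inner_quat_def)
  show "inner x x = 0 \<longleftrightarrow> x = 0"
    by (simp add: inner_quat_def quat_eq_iff add_nonneg_eq_0_iff)
  show "norm x = sqrt (inner x x)" by (simp add: inner_quat_def norm_quat_def power2_eq_square)
qed

end

instantiation quat :: euclidean_space
begin

definition Basis_quat_def: "Basis = {Quat 1 0 0 0, Quat 0 1 0 0, Quat 0 0 1 0, Quat 0 0 0 1}"

instance
proof
  show "(Basis :: quat set) \<noteq> {}" and "finite (Basis :: quat set)"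
    by (simp_all add: Basis_quat_def)
  show "inner u v = (if u = v then 1 else 0)" if "u \<in> Basis" "v \<in> Basis" for u v :: quat
    using that unfolding Basis_quat_def insert_iff empty_iff
    by (elim disjE) (simp_all add: inner_quat_def)
  show "(\<forall>u\<in>Basis. inner x u = 0) \<longleftrightarrow> x = 0" for x :: quat
    unfolding quat_eq_iff[of x] by (simp add: Basis_quat_def inner_quat_def)
qed

end

lemma norm_mult_quat: "norm (x * y) = norm x * norm y" for x y :: quat
  unfolding norm_quat_def real_sqrt_mult[symmetric] real_sqrt_eq_iff times_quat.simps
  by algebra

instantiation quat :: real_normed_div_algebra
begin

primcorec inverse_quat where
  "Re (inverse x) = Re x / ((Re x)\<^sup>2 + (Im1 x)\<^sup>2 + (Im2 x)\<^sup>2 + (Im3 x)\<^sup>2)"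
| "Im1 (inverse x) = - Im1 x / ((Re x)\<^sup>2 + (Im1 x)\<^sup>2 + (Im2 x)\<^sup>2 + (Im3 x)\<^sup>2)"
| "Im2 (inverse x) = - Im2 x / ((Re x)\<^sup>2 + (Im1 x)\<^sup>2 + (Im2 x)\<^sup>2 + (Im3 x)\<^sup>2)"
| "Im3 (inverse x) = - Im3 x / ((Re x)\<^sup>2 + (Im1 x)\<^sup>2 + (Im2 x)\<^sup>2 + (Im3 x)\<^sup>2)"

definition divide_quat_def: "x div y = x * inverse y" for x y :: quat

instance
proof
  fix x y :: quat
  show "x div y = x * inverse y" by (rule divide_quat_def)
  show "inverse (0 :: quat) = 0" by (simp add: quat_eq_iff)
  show "norm (x * y) = norm x * norm y" by (rule norm_mult_quat)
  assume "x \<noteq> 0"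
  define n where "n = (Re x)\<^sup>2 + (Im1 x)\<^sup>2 + (Im2 x)\<^sup>2 + (Im3 x)\<^sup>2"
  define c where "c = Quat (Re x) (- Im1 x) (- Im2 x) (- Im3 x)"
  have "n \<noteq> 0"
    using \<open>x \<noteq> 0\<close> inner_eq_zero_iff[of x] by (simp add: inner_quat_def n_def power2_eq_square)
  have inv: "inverse x = (1 / n) *\<^sub>R c"
    by (simp add: quat_eq_iff c_def n_def)
  have "c * x = n *\<^sub>R 1" and "x * c = n *\<^sub>R 1"
    by (simp_all add: quat_eq_iff c_def n_def power2_eq_square)
  then show "inverse x * x = 1" and "x * inverse x = 1"
    using \<open>n \<noteq> 0\<close> by (simp_all add: inv)
qed

end

lemma exp_quat_sums: "(\<lambda>n. z ^ n /\<^sub>R fact n) sums exp z" for z :: quat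
  by (rule exp_converges)


section \<open>Quaternionic differentiability\<close>

text \<open>
  \<open>f\<close> is a quaternion function on the neighbourhood \<open>G\<close> of \<open>z\<close>; its values outside \<open>G\<close>
  are irrelevant. Finite sequences of coefficients are covered by padding with zeros, so
  both cases are represented by sequences \<open>A, B :: nat \<Rightarrow> quat\<close>. The coefficients are not
  determined by \<open>f\<close>, but the value \<open>D\<close> of \<open>\<Sum>k. A k * B k\<close> is (lemma \<open>has_H_derivative_unique\<close>).
\<close>

definition has_H_derivative :: "quat set \<Rightarrow> (quat \<Rightarrow> quat) \<Rightarrow> quat \<Rightarrow> quat \<Rightarrow> bool" where
  "has_H_derivative G f z D \<longleftrightarrow>
     z \<in> interior G \<and>
     (\<exists>(A :: nat \<Rightarrow> quat) (B :: nat \<Rightarrow> quat) (\<omega> :: quat \<Rightarrow> quat).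
        (\<lambda>k. A k * B k) sums D \<and>
        (\<forall>h. z + h \<in> G \<longrightarrow>
           summable (\<lambda>k. A k * h * B k) \<and>
           f (z + h) - f z = (\<Sum>k. A k * h * B k) + \<omega> h) \<and>
        ((\<lambda>h. norm (\<omega> h) / norm h) \<longlongrightarrow> 0) (at 0))"

definition H_differentiable :: "quat set \<Rightarrow> (quat \<Rightarrow> quat) \<Rightarrow> quat \<Rightarrow> bool" where
  "H_differentiable G f z \<longleftrightarrow> (\<exists>D. has_H_derivative G f z D)"

definition H_deriv :: "quat set \<Rightarrow> (quat \<Rightarrow> quat) \<Rightarrow> quat \<Rightarrow> quat" where
  "H_deriv G f z = (THE D. has_H_derivative G f z D)"

lemma has_H_derivative_real_direction:
  assumes "has_H_derivative G f z D"
  shows "((\<lambda>t. (f (z + of_real t) - f z) /\<^sub>R t) \<longlongrightarrow> D) (at (0::real))"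
proof -
  obtain A B \<omega> where AB: "(\<lambda>k. A k * B k) sums D"
    and eq: "\<And>h. z + h \<in> G \<Longrightarrow> f (z + h) - f z = (\<Sum>k. A k * h * B k) + \<omega> h"
    and lim: "((\<lambda>h. norm (\<omega> h) / norm h) \<longlongrightarrow> 0) (at 0)"
    using assms unfolding has_H_derivative_def by blast
  have zG: "z \<in> interior G" using assms unfolding has_H_derivative_def by blast
  have of_real_lim: "filterlim (of_real :: real \<Rightarrow> quat) (at 0) (at 0)"
    unfolding filterlim_at
    by (auto simp: eventually_at_filter intro!: tendsto_eq_intros)
  have "((\<lambda>t::real. norm (\<omega> (of_real t)) / norm (of_real t :: quat)) \<longlongrightarrow> 0) (at 0)"
    by (rule filterlim_compose[OF lim of_real_lim])
  then have "((\<lambda>t::real. norm (\<omega> (of_real t) /\<^sub>R t)) \<longlongrightarrow> 0) (at 0)"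
    by (simp add: divide_inverse mult.commute)
  then have rem: "((\<lambda>t::real. \<omega> (of_real t) /\<^sub>R t) \<longlongrightarrow> 0) (at 0)"
    by (rule tendsto_norm_zero_cancel)
  have "((\<lambda>t::real. z + of_real t) \<longlongrightarrow> z) (at 0)"
    by (auto intro!: tendsto_eq_intros)
  then have "eventually (\<lambda>t::real. z + of_real t \<in> interior G) (at 0)"
    using zG by (rule topological_tendstoD[OF _ open_interior])
  then have inG: "eventually (\<lambda>t::real. z + of_real t \<in> G) (at 0)"
    by eventually_elim (use interior_subset in blast)
  have "(f (z + of_real t) - f z) /\<^sub>R t = D + \<omega> (of_real t) /\<^sub>R t"
    if "z + of_real t \<in> G" "t \<noteq> 0" for t :: real
  proof -
    have "(\<lambda>k. A k * of_real t * B k) = (\<lambda>k. t *\<^sub>R (A k * B k))"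
      by (simp add: of_real_def)
    then have "(\<Sum>k. A k * of_real t * B k) = t *\<^sub>R D"
      using sums_unique[OF sums_scaleR_right[OF AB, of t]] by simp
    then show ?thesis
      using eq[OF that(1)] that(2) by (simp add: scaleR_add_right)
  qed
  then have ev: "eventually (\<lambda>t::real. D + \<omega> (of_real t) /\<^sub>R t = (f (z + of_real t) - f z) /\<^sub>R t) (at 0)"
    using inG by (auto simp: eventually_at_filter elim!: eventually_mono)
  have "((\<lambda>t::real. D + \<omega> (of_real t) /\<^sub>R t) \<longlongrightarrow> D) (at 0)"
    using tendsto_add[OF tendsto_const rem] by simp
  then show ?thesis
    using ev by (rule Lim_transform_eventually)
qed

lemma has_H_derivative_unique:
  assumes "has_H_derivative G f z D" "has_H_derivative G f z D'"
  shows "D = D'"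
  using has_H_derivative_real_direction[OF assms(1)] has_H_derivative_real_direction[OF assms(2)]
  by (rule tendsto_unique[rotated]) simp

lemma has_H_derivative_imp_H_deriv:
  "has_H_derivative G f z D \<Longrightarrow> H_deriv G f z = D"
  unfolding H_deriv_def by (blast intro: has_H_derivative_unique)

end

theory Submission
  imports Defs
begin

text \<open>
  Every real-linear map \<open>L\<close> of the quaternions is a finite sum \<open>h \<mapsto> \<Sum>k. A k * h * B k\<close>: for
  the basis \<open>1, i, j, k\<close> the average of \<open>u * q * inverse u\<close> over \<open>u\<close> is the real part of \<open>q\<close>,
  and \<open>L h\<close> is the sum of \<open>L e\<close> times the real part of \<open>h * inverse e\<close> over \<open>e\<close>. Setting
  \<open>h = 1\<close> gives \<open>\<Sum>k. A k * B k = L 1\<close>, so a Frechet derivative \<open>L\<close> yields the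
  quaternionic derivative \<open>L 1\<close>. For the exponential, Frechet differentiability follows
  from termwise differentiation of the power series, and \<open>L 1\<close> is the derivative of
  \<open>t \<mapsto> exp (z + t) = exp z * exp t\<close> at \<open>t = 0\<close>.
\<close>

text \<open>Without commutativity the product rule leaves \<open>h\<close> in the place of the
  factor it replaces, so the usual \<open>n * x ^ (n - 1)\<close> splits into one term per
  position.\<close>

lemma has_derivative_power_noncomm:
  fixes x :: "'a::real_normed_algebra_1"
  shows "((\<lambda>x. x ^ n) has_derivative (\<lambda>h. \<Sum>j<n. x ^ j * h * x ^ (n - Suc j))) (at x within S)"
proof (induction n)
  case (Suc n)
  have "((\<lambda>x. x * x ^ n) has_derivative
      (\<lambda>h. x * (\<Sum>j<n. x ^ j * h * x ^ (n - Suc j)) + h * x ^ n)) (at x within S)"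
    by (rule has_derivative_mult[OF has_derivative_ident Suc])
  then show ?case
    by (simp add: sum.lessThan_Suc_shift sum_distrib_left mult.assoc add.commute del: sum.lessThan_Suc)
qed simp

text \<open>The bound depends on \<open>x\<close> only through \<open>R\<close>; divided by
  \<open>fact n\<close> it gives a common majorant on a ball for the derivatives of the exponential
  series.\<close>

lemma norm_sum_power_mult_le:
  fixes x h :: "'a::real_normed_algebra_1"
  assumes "norm x \<le> R"
  shows "norm (\<Sum>j<n. x ^ j * h * x ^ (n - Suc j)) \<le> of_nat n * R ^ (n - 1) * norm h"
proof -
  have R: "0 \<le> R" using assms norm_ge_zero order_trans by blast
  have pow: "norm (x ^ m) \<le> R ^ m" for m
    using norm_power_ineq[of x m] power_mono[OF assms norm_ge_zero, of m] by linarith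
  have "norm (x ^ j * h * x ^ (n - Suc j)) \<le> R ^ (n - 1) * norm h" if "j < n" for j
  proof -
    have "norm (x ^ j * h * x ^ (n - Suc j)) \<le> norm (x ^ j) * norm h * norm (x ^ (n - Suc j))"
      by (meson mult_right_mono norm_ge_zero norm_mult_ineq order_trans)
    also have "\<dots> \<le> R ^ j * norm h * R ^ (n - Suc j)"
      by (intro mult_mono pow order_refl mult_nonneg_nonneg norm_ge_zero zero_le_power R)
    also have "\<dots> = R ^ (n - 1) * norm h"
      using that by (simp add: power_add[symmetric] mult.commute mult.left_commute)
    finally show ?thesis .
  qed
  then have "norm (\<Sum>j<n. x ^ j * h * x ^ (n - Suc j)) \<le> (\<Sum>j<n. R ^ (n - 1) * norm h)"
    by (intro sum_norm_le) auto
  then show ?thesis by (simp add: mult.assoc)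
qed

lemma summable_of_nat_power_div_fact:
  fixes R :: real
  shows "summable (\<lambda>n. of_nat n * R ^ (n - 1) / fact n)"
proof -
  \<comment> \<open>Cancelling \<open>Suc n\<close> against \<open>fact (Suc n)\<close> turns the
    shifted series into the exponential series of \<open>R\<close>.\<close>
  have "(\<lambda>n. of_nat (Suc n) * R ^ (Suc n - 1) / fact (Suc n)) = (\<lambda>n. inverse (fact n) * R ^ n)"
    by (simp add: fun_eq_iff field_simps del: of_nat_Suc)
  then show ?thesis
    using summable_exp[of R] by (subst summable_Suc_iff[symmetric]) (simp only:)
qed

text \<open>Quantitative Weierstrass M-test: the error is controlled by the tail of the majorant
  alone, hence uniformly over all \<open>D\<close> dominated by \<open>M\<close>.\<close>

lemma norm_sum_diff_suminf_le:
  fixes D :: "nat \<Rightarrow> 'a::banach"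
  assumes "summable M" "\<And>i. norm (D i) \<le> M i"
  shows "norm (sum D {..<n} - suminf D) \<le> (\<Sum>i. M (i + n))"
proof -
  have "summable D" using assms by (rule summable_comparison_test')
  then have "sum D {..<n} - suminf D = - (\<Sum>i. D (i + n))"
    by (simp add: suminf_minus_initial_segment)
  moreover have "norm (\<Sum>i. D (i + n)) \<le> (\<Sum>i. M (i + n))"
    using assms by (intro norm_suminf_le) (auto simp: summable_iff_shift)
  ultimately show ?thesis by simp
qed

lemma exp_differentiable:
  fixes z :: "'a::{real_normed_algebra_1,banach}"
  shows "exp differentiable (at z)"
proof -
  \<comment> \<open>Any radius above \<open>norm z\<close> puts \<open>z\<close> inside the open
    ball around 0.\<close>
  define R where "R = norm z + 1"
  define D where "D i x h = (\<Sum>j<i. x ^ j * h * x ^ (i - Suc j)) /\<^sub>R fact i" for i :: nat and x h :: 'a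
  define M where "M i = of_nat i * R ^ (i - 1) / fact i" for i
  have M: "summable M" unfolding M_def by (rule summable_of_nat_power_div_fact)
  have D: "norm (D i x h) \<le> M i * norm h" if "norm x < R" for i x h
    using norm_sum_power_mult_le[where x = x and R = R and n = i and h = h] that
    by (simp add: D_def M_def divide_simps)
  have tail: "norm ((\<Sum>i<n. D i x h) - (\<Sum>i. D i x h)) \<le> (\<Sum>i. M (i + n)) * norm h"
    if "norm x < R" for n x h
  proof -
    have "norm ((\<Sum>i<n. D i x h) - (\<Sum>i. D i x h)) \<le> (\<Sum>i. M (i + n) * norm h)"
      using M D that by (intro norm_sum_diff_suminf_le) (auto intro: summable_mult2)
    also have "\<dots> = (\<Sum>i. M (i + n)) * norm h"
      using M by (intro suminf_mult2[symmetric]) (simp add: summable_iff_shift)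
    finally show ?thesis .
  qed
  \<comment> \<open>Termwise differentiation only produces some limit function \<open>g\<close>;
    uniqueness of sums identifies it with \<open>exp\<close> on the ball afterwards.\<close>
  have "\<exists>g. \<forall>x\<in>ball 0 R. (\<lambda>n. x ^ n /\<^sub>R fact n) sums g x \<and>
      (g has_derivative (\<lambda>h. \<Sum>i. D i x h)) (at x within ball 0 R)"
  proof (rule has_derivative_series[where x = z])
    show "((\<lambda>x. x ^ n /\<^sub>R fact n) has_derivative D n x) (at x within ball 0 R)" for n x
      unfolding D_def by (intro has_derivative_scaleR_right has_derivative_power_noncomm)
    show "\<forall>\<^sub>F n in sequentially. \<forall>x\<in>ball 0 R. \<forall>h.
        norm ((\<Sum>i<n. D i x h) - (\<Sum>i. D i x h)) \<le> e * norm h" if "e > 0" for e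
    proof -
      have "\<forall>\<^sub>F n in sequentially. (\<Sum>i. M (i + n)) < e"
        using suminf_exist_split2[OF M] that by (rule order_tendstoD)
      then show ?thesis
      proof eventually_elim
        case (elim n)
        show ?case
        proof (intro ballI allI)
          fix x h :: 'a
          assume "x \<in> ball 0 R"
          then have "norm ((\<Sum>i<n. D i x h) - (\<Sum>i. D i x h)) \<le> (\<Sum>i. M (i + n)) * norm h"
            by (intro tail) simp
          also have "\<dots> \<le> e * norm h"
            using elim by (intro mult_right_mono) auto
          finally show "norm ((\<Sum>i<n. D i x h) - (\<Sum>i. D i x h)) \<le> e * norm h" .
        qed
      qed
    qed
    show "(\<lambda>n. z ^ n /\<^sub>R fact n) sums exp z" by (rule exp_converges)
  qed (auto simp: R_def)
  then obtain g where g: "\<And>x. x \<in> ball 0 R \<Longrightarrow> (\<lambda>n. x ^ n /\<^sub>R fact n) sums g x"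
    "\<And>x. x \<in> ball 0 R \<Longrightarrow> (g has_derivative (\<lambda>h. \<Sum>i. D i x h)) (at x within ball 0 R)"
    by blast
  have z: "z \<in> ball 0 R" by (simp add: R_def)
  have "(g has_derivative (\<lambda>h. \<Sum>i. D i z h)) (at z)"
    using g(2)[OF z] unfolding at_within_open[OF z open_ball] .
  then have "(exp has_derivative (\<lambda>h. \<Sum>i. D i z h)) (at z)"
    using open_ball z
  proof (rule has_derivative_transform_within_open)
    show "g x = exp x" if "x \<in> ball 0 R" for x
      using sums_unique2[OF g(1)[OF that] exp_converges] .
  qed
  then show ?thesis by (auto simp: differentiable_def)
qed

lemma exp_has_derivative_at_one:
  fixes z :: "'a::{real_normed_algebra_1,banach}"
  assumes "(exp has_derivative L) (at z)"
  shows "L 1 = exp z"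
proof -
  have "((\<lambda>t::real. z + t *\<^sub>R 1) has_derivative (\<lambda>t. t *\<^sub>R 1)) (at 0)"
    by (auto intro!: derivative_eq_intros)
  then have "((\<lambda>t::real. exp (z + t *\<^sub>R 1)) has_derivative (\<lambda>t. L (t *\<^sub>R 1))) (at 0)"
    by (rule has_derivative_compose) (use assms in simp)
  moreover have "((\<lambda>t::real. exp z * exp (t *\<^sub>R 1)) has_derivative (\<lambda>t. t *\<^sub>R exp z)) (at 0)"
    using has_derivative_mult_right[OF exp_scaleR_has_vector_derivative_right[of "1::'a" 0 UNIV,
      unfolded has_vector_derivative_def], of "exp z"]
    by simp
  \<comment> \<open>The addition law requires commuting arguments, and real multiples of 1 are
    central.\<close>
  moreover have "exp (z + t *\<^sub>R 1) = exp z * exp (t *\<^sub>R 1)" for t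
    by (rule exp_add_commuting) simp
  ultimately have "(\<lambda>t. L (t *\<^sub>R 1)) = (\<lambda>t. t *\<^sub>R exp z)"
    by (intro has_derivative_unique[where f = "\<lambda>t. exp (z + t *\<^sub>R 1)"]) simp_all
  from fun_cong[OF this, of 1] show ?thesis by simp
qed

lemma of_real_inner_Basis_quat:
  fixes h e :: quat
  assumes "e \<in> Basis"
  shows "of_real (inner h e) = (\<Sum>u\<in>Basis. u * (h * inverse e) * inverse u) /\<^sub>R 4"
proof -
  have inv: "inverse (Quat 0 1 0 0) = Quat 0 (-1) 0 0" "inverse (Quat 0 0 1 0) = Quat 0 0 (-1) 0"
    "inverse (Quat 0 0 0 1) = Quat 0 0 0 (-1)" "inverse (Quat 1 0 0 0) = Quat 1 0 0 0"
    by (simp_all add: quat_eq_iff)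
  \<comment> \<open>Conjugation by a basis element fixes the real part. Each imaginary unit is fixed
    by 1 and by itself and negated by the other two, so the imaginary parts cancel.\<close>
  have "(\<Sum>u\<in>Basis. u * q * inverse u) = (4 * Re q) *\<^sub>R 1" for q
    by (simp add: Basis_quat_def inv) (simp add: quat_eq_iff of_real_def)
  \<comment> \<open>For a unit quaternion the inverse is the conjugate, and the real part of
    \<open>h\<close> times the conjugate of \<open>e\<close> is the Euclidean inner product.\<close>
  moreover have "Re (h * inverse e) = inner h e"
    using assms unfolding Basis_quat_def insert_iff empty_iff
    by (elim disjE) (simp_all add: inv inner_quat_def)
  ultimately show ?thesis by (simp add: of_real_def)
qed

lemma linear_quat_eq_sum:
  fixes L :: "quat \<Rightarrow> quat"
  assumes "linear L"
  shows "L h = (\<Sum>(e, u)\<in>Basis \<times> Basis. (L e * u /\<^sub>R 4) * h * (inverse e * inverse u))"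
proof -
  have "L h = L (\<Sum>e\<in>Basis. inner h e *\<^sub>R e)" by (simp add: euclidean_representation)
  \<comment> \<open>Scaling is rewritten as right multiplication by a real quaternion, for which the
    average over conjugations can be substituted.\<close>
  also have "\<dots> = (\<Sum>e\<in>Basis. L e * of_real (inner h e))"
    by (simp add: linear_sum[OF assms] linear_scale[OF assms] of_real_def)
  also have "\<dots> = (\<Sum>e\<in>Basis. \<Sum>u\<in>Basis. (L e * u /\<^sub>R 4) * h * (inverse e * inverse u))"
    by (intro sum.cong refl)
      (simp add: of_real_inner_Basis_quat sum_distrib_left scaleR_sum_right mult.assoc)
  finally show ?thesis by (simp add: sum.cartesian_product)
qed

lemma has_derivative_imp_has_H_derivative:
  assumes "(f has_derivative L) (at z)" "z \<in> interior G"
  shows "has_H_derivative G f z (L 1)"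
proof -
  define I where "I = (Basis \<times> Basis :: (quat \<times> quat) set)"
  obtain p where p: "bij_betw p {0..<card I} I"
    using ex_bij_betw_nat_finite[of I] by (auto simp: I_def)
  \<comment> \<open>The 16 pairs of basis elements are enumerated by \<open>p\<close>. From
    \<open>card I\<close> on, the zero in \<open>A\<close> kills each product, whatever
    \<open>p k\<close> gives to \<open>B\<close>.\<close>
  define A where "A k = (if k < card I then case p k of (e, u) \<Rightarrow> L e * u /\<^sub>R 4 else 0)" for k
  define B where "B k = (case p k of (e, u) \<Rightarrow> inverse e * inverse u)" for k
  define \<omega> where "\<omega> h = f (z + h) - f z - L h" for h
  have sums: "(\<lambda>k. A k * h * B k) sums L h" for h
  proof -
    have "L h = (\<Sum>(e, u)\<in>I. (L e * u /\<^sub>R 4) * h * (inverse e * inverse u))"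
      unfolding I_def using assms(1) by (intro linear_quat_eq_sum has_derivative_linear)
    also have "\<dots> = (\<Sum>k\<in>{0..<card I}. A k * h * B k)"
      unfolding sum.reindex_bij_betw[OF p, symmetric]
      by (intro sum.cong) (auto simp: A_def B_def split: prod.split)
    finally show ?thesis
      using sums_finite[of "{0..<card I}" "\<lambda>k. A k * h * B k"] by (simp add: A_def)
  qed
  have "((\<lambda>h. norm (\<omega> h) / norm h) \<longlongrightarrow> 0) (at 0)"
    using assms(1) by (simp add: has_derivative_at \<omega>_def)
  moreover have "f (z + h) - f z = (\<Sum>k. A k * h * B k) + \<omega> h" for h
    using sums_unique[OF sums[of h]] by (simp add: \<omega>_def)
  ultimately show ?thesis
    unfolding has_H_derivative_def
    using assms(2) sums[of 1] sums_summable[OF sums]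
    by (intro conjI exI[of _ A] exI[of _ B] exI[of _ \<omega>]) auto
qed

theorem proposition2p4:
  fixes z :: quat
  shows "H_differentiable UNIV exp z \<and> H_deriv UNIV exp z = exp z"
proof -
  obtain L where L: "(exp has_derivative L) (at z)"
    using exp_differentiable[of z] by (auto simp: differentiable_def)
  then have "has_H_derivative UNIV exp z (exp z)"
    using has_derivative_imp_has_H_derivative[OF L, of UNIV] exp_has_derivative_at_one[OF L]
    by simp
  then show ?thesis
    by (auto simp: H_differentiable_def has_H_derivative_imp_H_deriv)
qed

end
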